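(* Suppose $G$ is a finite connected graph (possibly with loops and parallel edges) with no vertex of degree $1$. Then $[0,1]\subseteq H(G)$, where $H(G)$ is the chord set of $G$.
   Context: Let $G=(V,E)$ be a finite connected graph with at least one edge, possibly with loops or multiple edges (a loop contributes $2$ to the degree of its vertex). Identify each edge of $G$ with the interval $[0,1]$ (glued along endpoints according to incidence) carrying the standard uniform (Lebesgue) measure. This makes $G$ a measure space $(G,\mu_G)$ with $\mu_G(G)=|E|$, and a topological space in which a subset is closed iff its intersection with each edge is closed. $L^1(G)$ denotes the set of functions $f:G\to\mathbb{R}$ whose restriction to each edge is Riemann-integrable; integrals over subsets of $G$ are with respect to $\mu_G$. $X(G)$ denotes the set of (nonempty) closed connected subsets of $G$. For $r\in[0,|E|]$, $X_r(G)=\{u\in X(G):\mu_G(u)=r\}$. The chord set $H(G)$ is the set of real numbers $r$ such that for every $f\in L^1(G)$ with $\int_G f\,d\mu_G=0$ there exists $U\in X_r(G)$ with $\int_U f\,d\mu_G=0$. *)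

theory Defs
  imports "HOL-Analysis.Analysis" "Graph_Theory.Digraph_Component"
begin

text \<open>
  A finite undirected multigraph is represented by a \<^locale>\<open>fin_digraph\<close>: loops and parallel
  arcs are allowed, and the direction of an arc only records which of its ends is glued to \<open>0\<close>
  and which to \<open>1\<close> when it is identified with the interval from \<open>0\<close> to \<open>1\<close>.  Connectedness is
  \<^const>\<open>Digraph_Component.connected\<close>, which ignores directions.
\<close>

text \<open>A loop is both an in-arc and an out-arc of its vertex, so it counts twice.\<close>

definition graph_degree :: "('v, 'e) pre_digraph \<Rightarrow> 'v \<Rightarrow> nat" where
  "graph_degree G v = in_degree G v + out_degree G v"

datatype ('v, 'e) graph_point = Vertex 'v | Interior 'e real

definition graph_points :: "('v, 'e) pre_digraph \<Rightarrow> ('v, 'e) graph_point set" where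
  "graph_points G = Vertex ` verts G \<union> {Interior e t | e t. e \<in> arcs G \<and> 0 < t \<and> t < 1}"

definition edge_map :: "('v, 'e) pre_digraph \<Rightarrow> 'e \<Rightarrow> real \<Rightarrow> ('v, 'e) graph_point" where
  "edge_map G e t = (if t = 0 then Vertex (tail G e)
                     else if t = 1 then Vertex (head G e)
                     else Interior e t)"

definition edge_part ::
    "('v, 'e) pre_digraph \<Rightarrow> ('v, 'e) graph_point set \<Rightarrow> 'e \<Rightarrow> real set" where
  "edge_part G A e = {t \<in> {0..1}. edge_map G e t \<in> A}"

lemma edge_part_Un: "edge_part G (A \<union> B) e = edge_part G A e \<union> edge_part G B e"
  and edge_part_Int: "edge_part G (A \<inter> B) e = edge_part G A e \<inter> edge_part G B e"
  and edge_part_Diff: "edge_part G (A - B) e = edge_part G A e - edge_part G B e"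
  and edge_part_Union: "edge_part G (\<Union>\<A>) e = (\<Union>A\<in>\<A>. edge_part G A e)"
  and edge_part_empty [simp]: "edge_part G {} e = {}"
  and edge_part_subset: "edge_part G A e \<subseteq> {0..1}"
  by (auto simp: edge_part_def)

lemma edge_part_points:
  assumes "wf_digraph G" "e \<in> arcs G"
  shows "edge_part G (graph_points G) e = {0..1}"
  using assms unfolding edge_part_def graph_points_def edge_map_def
  by (auto simp: wf_digraph.tail_in_verts wf_digraph.head_in_verts)

definition graph_topology :: "('v, 'e) pre_digraph \<Rightarrow> ('v, 'e) graph_point topology" where
  "graph_topology G = topology (\<lambda>U. U \<subseteq> graph_points G \<and>
     (\<forall>e\<in>arcs G. openin (top_of_set {0..1}) (edge_part G U e)))"

lemma openin_graph_topology:
  "openin (graph_topology G) U \<longleftrightarrow> U \<subseteq> graph_points G \<and>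
     (\<forall>e\<in>arcs G. openin (top_of_set {0..1}) (edge_part G U e))"
proof -
  have "istopology (\<lambda>U. U \<subseteq> graph_points G \<and>
     (\<forall>e\<in>arcs G. openin (top_of_set {0..1}) (edge_part G U e)))"
    unfolding istopology_def
    by (auto simp: edge_part_Int edge_part_Union intro!: openin_Int openin_Union)
  then show ?thesis
    by (simp add: graph_topology_def)
qed

lemma topspace_graph_topology:
  assumes "wf_digraph G"
  shows "topspace (graph_topology G) = graph_points G"
proof
  show "topspace (graph_topology G) \<subseteq> graph_points G"
    using openin_topspace[of "graph_topology G"] unfolding openin_graph_topology by blast
  have "openin (graph_topology G) (graph_points G)"
    by (simp add: openin_graph_topology edge_part_points[OF assms])
  then show "graph_points G \<subseteq> topspace (graph_topology G)"
    by (rule openin_subset)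
qed

lemma closedin_graph_topology:
  assumes "wf_digraph G"
  shows "closedin (graph_topology G) C \<longleftrightarrow>
    C \<subseteq> graph_points G \<and> (\<forall>e\<in>arcs G. closed (edge_part G C e))"
proof -
  have "openin (top_of_set {0..1}) (edge_part G (graph_points G - C) e) \<longleftrightarrow>
      closed (edge_part G C e)" if "e \<in> arcs G" for e
  proof -
    have "openin (top_of_set {0..1}) (edge_part G (graph_points G - C) e) \<longleftrightarrow>
        closedin (top_of_set {0..1}) (edge_part G C e)"
      using that by (simp add: closedin_def edge_part_Diff edge_part_points[OF assms] edge_part_subset)
    then show ?thesis
      by (simp add: closedin_closed_eq edge_part_subset)
  qed
  then show ?thesis
    by (auto simp: closedin_def topspace_graph_topology[OF assms] openin_graph_topology)
qed

text \<open>
  The Lebesgue sigma-algebra is used on every edge, not the Borel one, because Riemann-integrable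
  functions need not be Borel measurable.
\<close>

definition graph_sets :: "('v, 'e) pre_digraph \<Rightarrow> ('v, 'e) graph_point set set" where
  "graph_sets G =
     {A. A \<subseteq> graph_points G \<and> (\<forall>e\<in>arcs G. edge_part G A e \<in> sets lebesgue)}"

definition graph_measure :: "('v, 'e) pre_digraph \<Rightarrow> ('v, 'e) graph_point measure" where
  "graph_measure G = measure_of (graph_points G) (graph_sets G)
     (\<lambda>A. \<Sum>e\<in>arcs G. emeasure lebesgue (edge_part G A e))"

lemma sigma_algebra_graph_sets:
  assumes "wf_digraph G"
  shows "sigma_algebra (graph_points G) (graph_sets G)"
  unfolding sigma_algebra_iff2
  by (auto simp: graph_sets_def edge_part_Diff edge_part_points[OF assms] edge_part_Union
      intro!: sets.Diff sets.countable_UN)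

lemma space_graph_measure: "space (graph_measure G) = graph_points G"
  unfolding graph_measure_def by (rule space_measure_of) (auto simp: graph_sets_def)

lemma sets_graph_measure:
  assumes "wf_digraph G"
  shows "sets (graph_measure G) = graph_sets G"
  unfolding graph_measure_def
  by (rule sigma_algebra.sets_measure_of_eq[OF sigma_algebra_graph_sets[OF assms]])

lemma emeasure_graph_measure:
  assumes "wf_digraph G" "A \<in> graph_sets G"
  shows "emeasure (graph_measure G) A = (\<Sum>e\<in>arcs G. emeasure lebesgue (edge_part G A e))"
proof -
  let ?\<mu> = "\<lambda>A. \<Sum>e\<in>arcs G. emeasure lebesgue (edge_part G A e)"
  have "countably_additive (graph_sets G) ?\<mu>"
  proof (rule countably_additiveI)
    fix F :: "nat \<Rightarrow> ('a, 'b) graph_point set"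
    assume F: "range F \<subseteq> graph_sets G" "disjoint_family F"
    have "(\<Sum>i. emeasure lebesgue (edge_part G (F i) e)) =
        emeasure lebesgue (edge_part G (\<Union>(range F)) e)" if "e \<in> arcs G" for e
    proof -
      have "edge_part G (\<Union>(range F)) e = (\<Union>i. edge_part G (F i) e)"
        by (simp add: edge_part_Union)
      moreover have "disjoint_family (\<lambda>i. edge_part G (F i) e)"
        using F(2) unfolding disjoint_family_on_def by (auto simp: edge_part_def)
      moreover have "range (\<lambda>i. edge_part G (F i) e) \<subseteq> sets lebesgue"
        using F(1) that by (auto simp: graph_sets_def)
      ultimately show ?thesis
        by (simp add: suminf_emeasure del: emeasure_completion)
    qed
    then show "(\<Sum>i. ?\<mu> (F i)) = ?\<mu> (\<Union>(range F))"
      by (subst suminf_sum) auto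
  qed
  moreover have "positive (graph_sets G) ?\<mu>"
    by (simp add: positive_def)
  ultimately show ?thesis
    unfolding graph_measure_def
    by (rule emeasure_measure_of_sigma[OF sigma_algebra_graph_sets[OF assms(1)] _ _ assms(2), rotated])
qed

lemma measure_graph_points:
  assumes "wf_digraph G"
  shows "measure (graph_measure G) (graph_points G) = card (arcs G)"
proof -
  have "graph_points G \<in> graph_sets G"
    by (simp add: graph_sets_def edge_part_points[OF assms])
  then have "emeasure (graph_measure G) (graph_points G) = of_nat (card (arcs G))"
    by (simp add: emeasure_graph_measure[OF assms] edge_part_points[OF assms])
  then show ?thesis
    by (simp add: measure_def)
qed

text \<open>Riemann sums converge as the mesh tends to \<open>0\<close>; the library has no Riemann integral.\<close>

definition riemann_integrable :: "(real \<Rightarrow> real) \<Rightarrow> real \<Rightarrow> real \<Rightarrow> bool" where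
  "riemann_integrable f a b \<longleftrightarrow>
     (\<exists>I. \<forall>\<epsilon>>0. \<exists>\<delta>>0. \<forall>p. p tagged_division_of {a..b} \<and> (\<forall>(x, K)\<in>p. measure lborel K < \<delta>) \<longrightarrow>
        \<bar>(\<Sum>(x, K)\<in>p. measure lborel K * f x) - I\<bar> < \<epsilon>)"

definition graph_L1 :: "('v, 'e) pre_digraph \<Rightarrow> (('v, 'e) graph_point \<Rightarrow> real) set" where
  "graph_L1 G = {f. \<forall>e\<in>arcs G. riemann_integrable (\<lambda>t. f (edge_map G e t)) 0 1}"

definition closed_connected_sets ::
    "('v, 'e) pre_digraph \<Rightarrow> ('v, 'e) graph_point set set" where
  "closed_connected_sets G =
     {U. U \<noteq> {} \<and> closedin (graph_topology G) U \<and> connectedin (graph_topology G) U}"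

definition closed_connected_sets_of_measure ::
    "('v, 'e) pre_digraph \<Rightarrow> real \<Rightarrow> ('v, 'e) graph_point set set" where
  "closed_connected_sets_of_measure G r =
     {U \<in> closed_connected_sets G. measure (graph_measure G) U = r}"

definition chord_set :: "('v, 'e) pre_digraph \<Rightarrow> real set" where
  "chord_set G =
     {r. \<forall>f\<in>graph_L1 G. (LINT x|graph_measure G. f x) = 0 \<longrightarrow>
           (\<exists>U\<in>closed_connected_sets_of_measure G r. (LINT x:U|graph_measure G. f x) = 0)}"

end

theory Submission
  imports Defs
begin

text \<open>
  Let \<open>r > 0\<close>.  A window of length \<open>r \<le> 1\<close> is a subset of one of two kinds: an interval of length
  \<open>r\<close> inside an edge, or the union of two initial pieces, of lengths \<open>s\<close> and \<open>r - s\<close>, of different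
  half-edges at a common vertex.  Half-edges are encoded as darts, that is, edges with a direction,
  so that a loop has two darts at its vertex.  Because \<open>r \<le> 1\<close>, the two pieces overlap in a null set
  even if they belong to the same loop; so windows are closed connected sets of measure \<open>r\<close>
  (\<open>edge_segment_closed_connected\<close>, \<open>turn_closed_connected\<close>, \<open>turn_integral\<close>).

  Suppose that no window has integral \<open>0\<close>.  The integral changes continuously when a window slides
  along an edge or around a vertex, so it keeps its sign.  Sliding along an edge links
  the initial pieces of length \<open>r\<close> of the two darts of the edge; sliding around a vertex links those
  of any two darts at the vertex.  Since the graph is connected, all windows have the same sign
  (\<open>connected_dart_induct\<close>).

  This contradicts the vanishing of the total integral by averaging.  Let \<open>P d s\<close> be the integral of
  \<open>f\<close> over the first piece of length \<open>s\<close> of the dart \<open>d\<close>, and \<open>B d\<close> the integral of \<open>P d\<close> over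
  \<open>{0..r}\<close>.  For one edge, the integral over all windows inside it, plus \<open>B\<close> of its two darts, is
  exactly \<open>r\<close> times the integral of \<open>f\<close> over the edge (\<open>integral_window_average\<close>).  On the other
  hand \<open>B d + B d'\<close> is the integral over all windows that turn from \<open>d\<close> to \<open>d'\<close>, and has the common
  sign.  No vertex has degree \<open>1\<close>, so each dart has a partner at its vertex, and pairwise
  sums of one sign force the sum of all \<open>B d\<close> to have that sign (\<open>sum_pos_of_pairwise_pos\<close>).  Adding
  up, \<open>r\<close> times the total integral of \<open>f\<close> is nonzero, which is absurd (\<open>sliding_window_zero\<close>).

  The rest of the work connects this argument with the measure: a function that is Riemann integrable
  on each edge is Lebesgue integrable, and the measure of the graph is the image of a finite
  sum of copies of Lebesgue measure on the unit interval.
\<close>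

section \<open>Riemann integrability implies Lebesgue integrability\<close>

lemma measure_less_of_fine_ball:
  assumes p: "p tagged_division_of {a..b::real}" and fine: "(\<lambda>x. ball x (\<delta> / 3)) fine p"
    and xK: "(x, K) \<in> p"
  shows "measure lborel K < \<delta>"
proof -
  obtain u v where K: "K = {u..v}"
    using tagged_division_ofD(4)[OF p xK] by auto
  have x: "x \<in> {u..v}"
    using tagged_division_ofD(2)[OF p xK] by (simp add: K)
  then have "u \<in> {u..v}" "v \<in> {u..v}"
    by auto
  then have "u \<in> ball x (\<delta> / 3)" "v \<in> ball x (\<delta> / 3)"
    using fineD[OF fine xK] unfolding K by blast+
  then show ?thesis
    using x by (auto simp: K dist_real_def)
qed

text \<open>
  A uniform bound \<open>\<delta>\<close> on the mesh is a special gauge, so the Riemann integral is a special case of the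
  gauge integral.
\<close>

lemma riemann_integrable_imp_integrable_on:
  assumes "riemann_integrable h a b"
  shows "h integrable_on {a..b}"
proof -
  obtain I where I: "\<forall>\<epsilon>>0. \<exists>\<delta>>0. \<forall>p. p tagged_division_of {a..b} \<and>
      (\<forall>(x, K)\<in>p. measure lborel K < \<delta>) \<longrightarrow>
      \<bar>(\<Sum>(x, K)\<in>p. measure lborel K * h x) - I\<bar> < \<epsilon>"
    using assms unfolding riemann_integrable_def by blast
  have "\<exists>\<gamma>. gauge \<gamma> \<and> (\<forall>p. p tagged_division_of {a..b} \<and> \<gamma> fine p \<longrightarrow>
      norm ((\<Sum>(x, K)\<in>p. measure lborel K *\<^sub>R h x) - I) < \<epsilon>)" if pos: "\<epsilon> > 0" for \<epsilon>
  proof -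
    obtain \<delta> where \<delta>: "\<delta> > 0" "\<forall>p. p tagged_division_of {a..b} \<and>
        (\<forall>(x, K)\<in>p. measure lborel K < \<delta>) \<longrightarrow>
        \<bar>(\<Sum>(x, K)\<in>p. measure lborel K * h x) - I\<bar> < \<epsilon>"
      using I[rule_format, OF pos] by blast
    have "gauge (\<lambda>x. ball x (\<delta> / 3))"
      using \<delta>(1) by (simp add: gauge_ball)
    moreover have "norm ((\<Sum>(x, K)\<in>p. measure lborel K *\<^sub>R h x) - I) < \<epsilon>"
      if p: "p tagged_division_of {a..b}" and fine: "(\<lambda>x. ball x (\<delta> / 3)) fine p" for p
    proof -
      have "\<forall>(x, K)\<in>p. measure lborel K < \<delta>"
        by (auto intro: measure_less_of_fine_ball[OF p fine])
      with p have "\<bar>(\<Sum>(x, K)\<in>p. measure lborel K * h x) - I\<bar> < \<epsilon>"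
        by (intro \<delta>(2)[rule_format] conjI)
      then show ?thesis
        by simp
    qed
    ultimately show ?thesis
      by (intro exI[of _ "\<lambda>x. ball x (\<delta> / 3)"]) auto
  qed
  then have "(h has_integral I) {a..b}"
    unfolding has_integral_real by simp
  then show ?thesis
    by (rule has_integral_integrable)
qed

text \<open>
  Moving a single tag inside a cell \<open>K\<close> changes the Riemann sum by the length of \<open>K\<close> times the
  difference of the two values, and the sum can change by at most \<open>2\<close> if the mesh is small.  This
  bounds the function on each cell of positive length, and finitely many such cells cover the
  interval.
\<close>

lemma riemann_integrable_bounded:
  assumes "riemann_integrable h a b" "a < b"
  shows "bounded (h ` {a..b})"
proof -
  obtain I where I: "\<forall>\<epsilon>>0. \<exists>\<delta>>0. \<forall>p. p tagged_division_of {a..b} \<and>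
      (\<forall>(x, K)\<in>p. measure lborel K < \<delta>) \<longrightarrow>
      \<bar>(\<Sum>(x, K)\<in>p. measure lborel K * h x) - I\<bar> < \<epsilon>"
    using assms(1) unfolding riemann_integrable_def by blast
  obtain \<delta> where \<delta>: "\<delta> > 0" "\<forall>p. p tagged_division_of {a..b} \<and>
      (\<forall>(x, K)\<in>p. measure lborel K < \<delta>) \<longrightarrow>
      \<bar>(\<Sum>(x, K)\<in>p. measure lborel K * h x) - I\<bar> < 1"
    using I[rule_format, OF zero_less_one] by blast
  obtain p where p: "p tagged_division_of {a..b}" and fine: "(\<lambda>x. ball x (\<delta> / 3)) fine p"
    using fine_division_exists_real[of "\<lambda>x. ball x (\<delta> / 3)" a b] \<delta>(1) by (auto simp: gauge_ball)
  define D where "D = {K \<in> snd ` p. measure lborel K \<noteq> 0}"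
  have "snd ` p division_of {a..b}"
    using p by (rule division_of_tagged_division)
  then have D: "D division_of {a..b}"
    unfolding D_def using division_of_nontrivial[of "snd ` p" a b] assms(2) by simp
  have small: "measure lborel K < \<delta>" if "K \<in> D" for K
    using that measure_less_of_fine_ball[OF p fine] by (auto simp: D_def)
  have fin: "finite D"
    using D by (rule division_of_finite)
  \<comment> \<open>Indexing the sum by cells, not by tagged cells, leaves one freely chosen tag for each cell.\<close>
  have riemann_sum: "\<bar>(\<Sum>K\<in>D. measure lborel K * h (t K)) - I\<bar> < 1"
    if t: "\<And>K. K \<in> D \<Longrightarrow> t K \<in> K" for t
  proof -
    have inj: "inj_on (\<lambda>K. (t K, K)) D"
      by (auto simp: inj_on_def)
    have "(\<lambda>K. (t K, K)) ` D tagged_division_of {a..b}"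
    proof (rule tagged_division_ofI)
      fix x\<^sub>1 K\<^sub>1 x\<^sub>2 K\<^sub>2
      assume "(x\<^sub>1, K\<^sub>1) \<in> (\<lambda>K. (t K, K)) ` D" "(x\<^sub>2, K\<^sub>2) \<in> (\<lambda>K. (t K, K)) ` D"
        "(x\<^sub>1, K\<^sub>1) \<noteq> (x\<^sub>2, K\<^sub>2)"
      then show "interior K\<^sub>1 \<inter> interior K\<^sub>2 = {}"
        by (intro division_ofD(5)[OF D]) auto
    next
      show "\<Union>{K. \<exists>x. (x, K) \<in> (\<lambda>K. (t K, K)) ` D} = {a..b}"
        using division_ofD(6)[OF D] by (auto simp: image_iff)
    qed (use division_ofD(2,4)[OF D] fin t in \<open>auto simp: image_iff\<close>)
    moreover have "\<forall>(x, K)\<in>(\<lambda>K. (t K, K)) ` D. measure lborel K < \<delta>"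
      using small by blast
    ultimately have "\<bar>(\<Sum>(x, K)\<in>(\<lambda>K. (t K, K)) ` D. measure lborel K * h x) - I\<bar> < 1"
      using \<delta>(2) by blast
    then show ?thesis
      by (simp add: sum.reindex[OF inj])
  qed
  define t where "t K = (SOME x. x \<in> K)" for K :: "real set"
  have t: "t K \<in> K" if "K \<in> D" for K
    unfolding t_def using division_ofD(3)[OF D that] by (simp add: some_in_eq)
  have bdd: "bounded (h ` K)" if K: "K \<in> D" for K
  proof -
    have "measure lborel K > 0"
      using K content_pos_le[of K] by (auto simp: D_def less_le)
    have "norm (h x) \<le> 2 / measure lborel K + \<bar>h (t K)\<bar>" if x: "x \<in> K" for x
    proof -
      have "\<bar>(\<Sum>L\<in>D. measure lborel L * h ((t(K := x)) L)) - I\<bar> < 1"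
        using t x by (intro riemann_sum) auto
      moreover have "(\<Sum>L\<in>D. measure lborel L * h ((t(K := x)) L)) =
          measure lborel K * h x + (\<Sum>L\<in>D - {K}. measure lborel L * h (t L))"
        using fin K by (simp add: sum.remove[of D K])
      moreover have "\<bar>(\<Sum>L\<in>D. measure lborel L * h (t L)) - I\<bar> < 1"
        using t by (intro riemann_sum)
      moreover have "(\<Sum>L\<in>D. measure lborel L * h (t L)) =
          measure lborel K * h (t K) + (\<Sum>L\<in>D - {K}. measure lborel L * h (t L))"
        using fin K by (simp add: sum.remove[of D K])
      ultimately have "\<bar>measure lborel K * h x - measure lborel K * h (t K)\<bar> < 2"
        by linarith
      then have "measure lborel K * \<bar>h x - h (t K)\<bar> < 2"
        using \<open>measure lborel K > 0\<close> by (simp add: abs_mult flip: right_diff_distrib)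
      then have "\<bar>h x - h (t K)\<bar> < 2 / measure lborel K"
        using \<open>measure lborel K > 0\<close> by (simp add: field_simps)
      then show ?thesis
        by simp
    qed
    then show ?thesis
      by (auto simp: bounded_iff)
  qed
  have "h ` {a..b} = (\<Union>K\<in>D. h ` K)"
    using division_ofD(6)[OF D] by blast
  then show ?thesis
    using fin bdd by (simp add: bounded_Union)
qed

text \<open>
  A gauge integral need not be absolute; boundedness is what makes this one a Lebesgue integral.
\<close>

lemma riemann_integrable_imp_absolutely_integrable:
  assumes "riemann_integrable h a b" "a < b"
  shows "h absolutely_integrable_on {a..b}"
proof -
  obtain B where B: "\<forall>x\<in>{a..b}. norm (h x) \<le> B"
    using riemann_integrable_bounded[OF assms] unfolding bounded_iff by blast
  then show ?thesis
    using riemann_integrable_imp_integrable_on[OF assms(1)]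
    by (intro absolutely_integrable_integrable_bound[where g = "\<lambda>_. B"]) (use B in auto)
qed

section \<open>Signs and averages\<close>

lemma sgn_eq_if_nonzero_on_interval:
  fixes g :: "real \<Rightarrow> real"
  assumes "continuous_on {a..b} g" "\<And>x. x \<in> {a..b} \<Longrightarrow> g x \<noteq> 0" "a \<le> b"
  shows "sgn (g a) = sgn (g b)"
proof (rule ccontr)
  assume "sgn (g a) \<noteq> sgn (g b)"
  then consider "g a < 0" "g b > 0" | "g a > 0" "g b < 0"
    using assms(2)[of a] assms(2)[of b] assms(3) by (force simp: sgn_if split: if_splits)
  then show False
    using IVT'[of g a 0 b] IVT2'[of g b 0 a] assms by cases force+
qed

lemma sgn_eq_on_interval:
  fixes g :: "real \<Rightarrow> real"
  assumes "continuous_on {a..b} g" "\<And>x. x \<in> {a..b} \<Longrightarrow> g x \<noteq> 0" "x \<in> {a..b}"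
  shows "sgn (g x) = sgn (g a)"
proof -
  have "continuous_on {a..x} g"
    using assms(1,3) by (auto intro: continuous_on_subset)
  then show ?thesis
    using sgn_eq_if_nonzero_on_interval[of a x g] assms(2,3) by auto
qed

lemma integral_pos_of_continuous_pos:
  fixes g :: "real \<Rightarrow> real"
  assumes "continuous_on {a..b} g" "\<And>x. x \<in> {a..b} \<Longrightarrow> g x > 0" "a < b"
  shows "integral {a..b} g > 0"
proof -
  obtain m where m: "m \<in> {a..b}" "\<And>x. x \<in> {a..b} \<Longrightarrow> g m \<le> g x"
    using continuous_attains_inf[of "{a..b}" g] assms by auto
  have "0 < (b - a) * g m"
    using assms m by auto
  also have "\<dots> = integral {a..b} (\<lambda>_. g m)"
    using assms(3) by simp
  also have "\<dots> \<le> integral {a..b} g"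
    using m by (intro integral_le integrable_continuous_interval assms) auto
  finally show ?thesis .
qed

text \<open>
  At most one summand can be nonpositive, and adding any other summand outweighs it.
\<close>

lemma sum_pos_of_pairwise_pos:
  fixes B :: "'a \<Rightarrow> real"
  assumes "finite D" "card D \<ge> 2"
    and pair: "\<And>x y. x \<in> D \<Longrightarrow> y \<in> D \<Longrightarrow> x \<noteq> y \<Longrightarrow> B x + B y > 0"
  shows "(\<Sum>x\<in>D. B x) > 0"
proof (cases "\<forall>x\<in>D. B x > 0")
  case True
  then show ?thesis
    using assms(1,2) by (intro sum_pos) auto
next
  case False
  then obtain x where x: "x \<in> D" "B x \<le> 0"
    by (auto simp: not_less)
  have "card (D - {x}) \<ge> 1"
    using assms(1,2) x(1) by simp
  then obtain y where y: "y \<in> D" "y \<noteq> x"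
    by (metis Diff_iff card.empty ex_in_conv insertI1 not_one_le_zero)
  have pos: "B z > 0" if "z \<in> D" "z \<noteq> x" for z
    using pair[of x z] that x by auto
  have "0 < B x + B y"
    using pair[of x y] x y by auto
  also have "\<dots> \<le> B x + B y + (\<Sum>z\<in>D - {x} - {y}. B z)"
    using sum_nonneg[of "D - {x} - {y}" B] pos by (force simp: less_imp_le)
  also have "\<dots> = (\<Sum>z\<in>D. B z)"
    using assms(1) x y by (simp add: sum.remove[of D x] sum.remove[of "D - {x}" y])
  finally show ?thesis .
qed

text \<open>
  Read \<open>Q\<close> as a primitive, vanishing at \<open>0\<close>, of \<open>f\<close> on one edge.  The first integral is over windows
  inside the edge, and counts points near its ends with too small a weight; the other two integrals are over the parts, on
  this edge, of windows that reach across its two ends, and they restore the weight \<open>r\<close> everywhere.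
  The proof only splits the integral of \<open>Q\<close> at \<open>r\<close> and at \<open>1 - r\<close>.
\<close>

lemma integral_window_average:
  fixes Q :: "real \<Rightarrow> real"
  assumes cont: "continuous_on {0..1} Q" and r: "0 \<le> r" "r \<le> 1"
  shows "integral {0..1 - r} (\<lambda>a. Q (a + r) - Q a) + integral {0..r} Q
    + integral {0..r} (\<lambda>s. Q 1 - Q (1 - s)) = r * Q 1"
proof -
  have int: "Q integrable_on {u..v}" if "0 \<le> u" "v \<le> 1" for u v
    using that by (intro integrable_continuous_interval continuous_on_subset[OF cont]) auto
  have shift: "integral {0..1 - r} (\<lambda>a. Q (a + r)) = integral {r..1} Q"
    using integral_shift_real_ivl[of r r 1 Q] by simp
  have "integral {0..1 - r} (\<lambda>a. Q (a + r) - Q a) = integral {r..1} Q - integral {0..1 - r} Q"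
    unfolding shift[symmetric] using r
    by (intro integral_diff integrable_continuous_interval continuous_intros
        continuous_on_compose2[OF cont]) auto
  moreover have "integral {0..r} (\<lambda>s. Q (1 - s)) = integral {1 - r..1} Q"
  proof -
    have "integral {0..r} (\<lambda>s. Q (1 - s)) = integral {- r..0} (\<lambda>s. Q (1 + s))"
      using Henstock_Kurzweil_Integration.integral_reflect_real[of 0 "- r" "\<lambda>s. Q (1 + s)"] by (simp del: Henstock_Kurzweil_Integration.integral_reflect_real)
    then show ?thesis
      using integral_shift_real_ivl[of "1 - r" 1 1 Q] by (simp add: add.commute)
  qed
  moreover have "integral {0..r} (\<lambda>s. Q 1 - Q (1 - s)) = r * Q 1 - integral {0..r} (\<lambda>s. Q (1 - s))"
    using r by (subst integral_diff)
      (auto intro!: integrable_continuous_interval continuous_intros continuous_on_compose2[OF cont])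
  moreover have "integral {0..r} Q + integral {r..1} Q = integral {0..1} Q"
    using int r by (intro Henstock_Kurzweil_Integration.integral_combine) auto
  moreover have "integral {0..1 - r} Q + integral {1 - r..1} Q = integral {0..1} Q"
    using int r by (intro Henstock_Kurzweil_Integration.integral_combine) auto
  ultimately show ?thesis
    by linarith
qed

section \<open>Darts and the sliding argument\<close>

text \<open>
  The dart \<open>(e, True)\<close> runs along \<open>e\<close> from \<open>0\<close> to \<open>1\<close>, and \<open>(e, False)\<close> from \<open>1\<close> to \<open>0\<close>.
\<close>

definition darts :: "('v, 'e) pre_digraph \<Rightarrow> ('e \<times> bool) set" where
  "darts G = arcs G \<times> UNIV"

definition dart_start :: "('v, 'e) pre_digraph \<Rightarrow> 'e \<times> bool \<Rightarrow> 'v" where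
  "dart_start G d = (if snd d then tail G (fst d) else head G (fst d))"

definition darts_at :: "('v, 'e) pre_digraph \<Rightarrow> 'v \<Rightarrow> ('e \<times> bool) set" where
  "darts_at G v = {d \<in> darts G. dart_start G d = v}"

lemma darts_at_eq: "darts_at G v = out_arcs G v \<times> {True} \<union> in_arcs G v \<times> {False}"
  by (auto simp: darts_at_def darts_def dart_start_def out_arcs_def in_arcs_def)

text \<open>
  Darts are chosen to make this true for loops as well: a loop contributes two darts to its vertex.
\<close>

lemma card_darts_at:
  assumes "fin_digraph G"
  shows "card (darts_at G v) = graph_degree G v"
proof -
  interpret fin_digraph G by fact
  show ?thesis
    unfolding darts_at_eq graph_degree_def in_degree_def out_degree_def
    by (subst card_Un_disjoint) (auto simp: card_cartesian_product)
qed

text \<open>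
  If \<open>Q e\<close> is the primitive, vanishing at \<open>0\<close>, of a function on the edge \<open>e\<close>, this is the integral of
  that function over the first piece of length \<open>s\<close> of the dart \<open>d\<close>.
\<close>

definition dart_primitive :: "('e \<Rightarrow> real \<Rightarrow> real) \<Rightarrow> 'e \<times> bool \<Rightarrow> real \<Rightarrow> real" where
  "dart_primitive Q d s = (if snd d then Q (fst d) s else Q (fst d) 1 - Q (fst d) (1 - s))"

lemma continuous_on_dart_primitive:
  assumes "continuous_on {0..1} (Q (fst d))"
  shows "continuous_on {0..1} (dart_primitive Q d)"
proof (cases "snd d")
  case False
  have "continuous_on {0..1} (\<lambda>s. Q (fst d) (1 - s))"
    by (rule continuous_on_compose2[OF assms]) (auto intro!: continuous_intros)
  then show ?thesis
    using False unfolding dart_primitive_def by (auto intro!: continuous_intros)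
qed (use assms in \<open>simp add: dart_primitive_def[abs_def]\<close>)

text \<open>
  Connectedness of the graph in terms of darts: reversing darts and turning at vertices generates all
  darts from one of them.
\<close>

lemma connected_dart_induct:
  assumes G: "wf_digraph G" "Digraph_Component.connected G"
    and darts: "d\<^sub>0 \<in> darts G" "d \<in> darts G"
    and base: "P d\<^sub>0"
    and rev: "\<And>e b. e \<in> arcs G \<Longrightarrow> P (e, b) \<Longrightarrow> P (e, \<not> b)"
    and turn: "\<And>d d'. d \<in> darts G \<Longrightarrow> d' \<in> darts G \<Longrightarrow> dart_start G d = dart_start G d' \<Longrightarrow>
      P d \<Longrightarrow> P d'"
  shows "P d"
proof -
  interpret wf_digraph G by fact
  interpret S: pair_wf_digraph "mk_symmetric G" ..
  have start: "dart_start G d \<in> verts G" if "d \<in> darts G" for d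
    using that by (auto simp: dart_start_def darts_def)
  have "dart_start G d\<^sub>0 \<rightarrow>\<^sup>*\<^bsub>mk_symmetric G\<^esub> dart_start G d"
    using G(2) start[OF darts(1)] start[OF darts(2)]
    by (simp add: connected_def strongly_connected_def)
  then have "\<forall>d'\<in>darts G. dart_start G d' = dart_start G d \<longrightarrow> P d'"
  proof (induction rule: S.reachable_induct)
    case base
    then show ?case
      using turn[OF darts(1)] assms(5) by auto
  next
    case (step x y)
    then have "(x, y) \<in> parcs (mk_symmetric G)"
      by simp
    then obtain e where e: "e \<in> arcs G" "(x, y) = (tail G e, head G e) \<or> (x, y) = (head G e, tail G e)"
      by (auto simp: parcs_mk_symmetric)
    define b where "b = (x = tail G e \<and> y = head G e)"
    have b: "dart_start G (e, b) = x" "dart_start G (e, \<not> b) = y"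
      using e(2) by (auto simp: dart_start_def b_def)
    have in_darts: "(e, b') \<in> darts G" for b'
      using e(1) by (simp add: darts_def)
    have "P (e, b)"
      using step.IH in_darts b(1) by blast
    then have "P (e, \<not> b)"
      by (rule rev[OF e(1)])
    then show ?case
      using turn[OF in_darts] b(2) by metis
  qed
  then show ?thesis
    using darts(2) by blast
qed

lemma sum_darts: "(\<Sum>d\<in>darts G. B d) = (\<Sum>e\<in>arcs G. B (e, True) + B (e, False))"
  for B :: "'e \<times> bool \<Rightarrow> real"
proof -
  have "(\<Sum>d\<in>darts G. B d) = (\<Sum>e\<in>arcs G. \<Sum>b\<in>UNIV. B (e, b))"
    unfolding darts_def by (simp add: sum.cartesian_product)
  then show ?thesis
    by (simp add: UNIV_bool add.commute)
qed

text \<open>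
  This is where the degree condition enters: a vertex at which some dart starts has at least two.
\<close>

lemma sum_darts_pos_of_turns_pos:
  fixes B :: "'e \<times> bool \<Rightarrow> real"
  assumes G: "fin_digraph G" "arcs G \<noteq> {}" "\<forall>v\<in>verts G. graph_degree G v \<noteq> 1"
    and turn: "\<And>d d'. d \<in> darts G \<Longrightarrow> d' \<in> darts G \<Longrightarrow> d \<noteq> d' \<Longrightarrow>
      dart_start G d = dart_start G d' \<Longrightarrow> B d + B d' > 0"
  shows "(\<Sum>d\<in>darts G. B d) > 0"
proof -
  interpret fin_digraph G by fact
  have fin: "finite (darts G)"
    by (simp add: darts_def)
  have start: "dart_start G ` darts G \<subseteq> verts G"
    by (auto simp: dart_start_def darts_def)
  have pos: "(\<Sum>d\<in>darts_at G v. B d) > 0" if v: "v \<in> dart_start G ` darts G" for v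
  proof (rule sum_pos_of_pairwise_pos)
    show fin': "finite (darts_at G v)"
      using fin by (simp add: darts_at_def)
    have "darts_at G v \<noteq> {}"
      using v by (auto simp: darts_at_def)
    then have "card (darts_at G v) \<noteq> 0"
      using fin' by simp
    moreover have "card (darts_at G v) \<noteq> 1"
      using G(3) v start by (auto simp: card_darts_at[OF G(1)])
    ultimately show "2 \<le> card (darts_at G v)"
      by linarith
  qed (auto simp: darts_at_def intro: turn)
  have "(\<Sum>d\<in>darts G. B d) = (\<Sum>v\<in>dart_start G ` darts G. \<Sum>d\<in>darts_at G v. B d)"
    unfolding darts_at_def by (rule sum.image_gen[OF fin])
  also have "\<dots> > 0"
    by (rule sum_pos) (use fin G(2) pos in \<open>auto simp: darts_def\<close>)
  finally show ?thesis .
qed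

text \<open>
  The sliding and averaging argument, on primitives \<open>Q e\<close> only.  The two alternatives are the two
  kinds of windows.  The number \<open>c\<close> in the proof is the common sign of all windows, and everything is
  multiplied by \<open>c\<close> to make it positive.  The hypothesis \<open>0 < r\<close> makes the integrals over
  windows around a vertex strictly positive; windows inside an edge contribute a nonnegative amount,
  which is zero for \<open>r = 1\<close>.
\<close>

lemma sliding_window_zero:
  fixes Q :: "'e \<Rightarrow> real \<Rightarrow> real"
  assumes G: "fin_digraph G" "Digraph_Component.connected G" "arcs G \<noteq> {}"
      "\<forall>v\<in>verts G. graph_degree G v \<noteq> 1"
    and cont: "\<And>e. e \<in> arcs G \<Longrightarrow> continuous_on {0..1} (Q e)"
    and Q0: "\<And>e. e \<in> arcs G \<Longrightarrow> Q e 0 = 0"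
    and total: "(\<Sum>e\<in>arcs G. Q e 1) = 0"
    and r: "0 < r" "r \<le> 1"
  shows "(\<exists>e\<in>arcs G. \<exists>a\<in>{0..1 - r}. Q e (a + r) - Q e a = 0) \<or>
    (\<exists>d\<in>darts G. \<exists>d'\<in>darts G. d \<noteq> d' \<and> dart_start G d = dart_start G d' \<and>
      (\<exists>s\<in>{0..r}. dart_primitive Q d s + dart_primitive Q d' (r - s) = 0))"
proof (rule ccontr)
  let ?P = "dart_primitive Q"
  assume "\<not> ?thesis"
  then have edge: "\<And>e a. e \<in> arcs G \<Longrightarrow> a \<in> {0..1 - r} \<Longrightarrow> Q e (a + r) - Q e a \<noteq> 0"
    and turn: "\<And>d d' s. d \<in> darts G \<Longrightarrow> d' \<in> darts G \<Longrightarrow> d \<noteq> d' \<Longrightarrow>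
      dart_start G d = dart_start G d' \<Longrightarrow> s \<in> {0..r} \<Longrightarrow> ?P d s + ?P d' (r - s) \<noteq> 0"
    by blast+
  have contP: "continuous_on {0..1} (?P d)" if "d \<in> darts G" for d
    using that by (intro continuous_on_dart_primitive cont) (auto simp: darts_def)
  have P0: "?P d 0 = 0" if "d \<in> darts G" for d
    using that Q0 by (auto simp: darts_def dart_primitive_def)
  have cont_edge: "continuous_on {0..1 - r} (\<lambda>a. Q e (a + r) - Q e a)" if "e \<in> arcs G" for e
    using r by (intro continuous_intros continuous_on_compose2[OF cont[OF that]]) auto
  have cont_turn: "continuous_on {0..r} (\<lambda>s. ?P d s + ?P d' (r - s))"
    if "d \<in> darts G" "d' \<in> darts G" for d d'
    using r that by (intro continuous_intros continuous_on_compose2[OF contP]) auto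
  obtain e\<^sub>0 where e\<^sub>0: "e\<^sub>0 \<in> arcs G"
    using G(3) by blast
  define c where "c = sgn (?P (e\<^sub>0, True) r)"
  have sgn_P: "sgn (?P d r) = c" if d: "d \<in> darts G" for d
  proof (rule connected_dart_induct[where P = "\<lambda>d. sgn (?P d r) = c"])
    show "wf_digraph G" "Digraph_Component.connected G"
      using G fin_digraph.axioms(1) by blast+
    show "(e\<^sub>0, True) \<in> darts G" "d \<in> darts G"
      using e\<^sub>0 d by (auto simp: darts_def)
    show "sgn (?P (e\<^sub>0, True) r) = c"
      by (simp add: c_def)
  next
    fix e b assume e: "e \<in> arcs G" and IH: "sgn (?P (e, b) r) = c"
    have "sgn (Q e 1 - Q e (1 - r)) = sgn (Q e r - Q e 0)"
      using sgn_eq_on_interval[OF cont_edge[OF e] edge[OF e], of "1 - r"] r by simp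
    then have "sgn (?P (e, False) r) = sgn (?P (e, True) r)"
      using Q0[OF e] by (simp add: dart_primitive_def)
    then show "sgn (?P (e, \<not> b) r) = c"
      using IH by (cases b) auto
  next
    fix d d' assume dd': "d \<in> darts G" "d' \<in> darts G" "dart_start G d = dart_start G d'"
      and IH: "sgn (?P d r) = c"
    show "sgn (?P d' r) = c"
    proof (cases "d = d'")
      case False
      then show ?thesis
        using sgn_eq_on_interval[OF cont_turn[OF dd'(1,2)] turn[OF dd'(1,2) _ dd'(3)], of r]
          r IH P0 dd' by simp
    qed (use IH in simp)
  qed
  have "?P (e\<^sub>0, True) r \<noteq> 0"
    using edge[OF e\<^sub>0, of 0] r by (simp add: dart_primitive_def Q0[OF e\<^sub>0])
  then have c: "c \<noteq> 0"
    by (simp add: c_def sgn_zero_iff)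
  have pos_if_sgn: "c * x > 0" if "sgn x = c" for x
    using that c by (metis abs_sgn mult.commute zero_less_abs_iff sgn_zero_iff)
  have edge_pos: "c * (Q e (a + r) - Q e a) > 0" if e: "e \<in> arcs G" and a: "a \<in> {0..1 - r}" for e a
  proof -
    have "sgn (Q e (a + r) - Q e a) = sgn (Q e (0 + r) - Q e 0)"
      by (rule sgn_eq_on_interval[OF cont_edge[OF e] edge[OF e] a])
    also have "\<dots> = c"
      using sgn_P[of "(e, True)"] e by (simp add: darts_def dart_primitive_def Q0)
    finally show ?thesis
      by (rule pos_if_sgn)
  qed
  have turn_pos: "c * (?P d s + ?P d' (r - s)) > 0"
    if dd': "d \<in> darts G" "d' \<in> darts G" "d \<noteq> d'" "dart_start G d = dart_start G d'"
      and s: "s \<in> {0..r}" for d d' s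
  proof -
    have "sgn (?P d s + ?P d' (r - s)) = sgn (?P d 0 + ?P d' (r - 0))"
      by (rule sgn_eq_on_interval[OF cont_turn[OF dd'(1,2)] turn[OF dd'] s])
    also have "\<dots> = c"
      using dd' by (simp add: P0 sgn_P)
    finally show ?thesis
      by (rule pos_if_sgn)
  qed
  define B where "B d = integral {0..r} (\<lambda>s. c * ?P d s)" for d
  have intP: "(\<lambda>s. c * ?P d s) integrable_on {0..r}" if "d \<in> darts G" for d
    using r by (intro integrable_continuous_interval continuous_intros
        continuous_on_subset[OF contP[OF that]]) auto
  have intP': "(\<lambda>s. c * ?P d (r - s)) integrable_on {0..r}" if "d \<in> darts G" for d
    using r by (intro integrable_continuous_interval continuous_intros
        continuous_on_compose2[OF contP[OF that]]) auto
  have reflect: "integral {0..r} (\<lambda>s. c * ?P d (r - s)) = B d" for d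
  proof -
    have "integral {0..r} (\<lambda>s. c * ?P d (r - s)) = integral {- r..0} (\<lambda>s. c * ?P d (s + r))"
      using Henstock_Kurzweil_Integration.integral_reflect_real[of 0 "- r" "\<lambda>s. c * ?P d (s + r)"]
      by (simp del: Henstock_Kurzweil_Integration.integral_reflect_real)
    then show ?thesis
      using integral_shift_real_ivl[of 0 r r "\<lambda>s. c * ?P d s"] by (auto simp: B_def)
  qed
  have "B d + B d' > 0"
    if dd': "d \<in> darts G" "d' \<in> darts G" "d \<noteq> d'" "dart_start G d = dart_start G d'" for d d'
  proof -
    have "0 < integral {0..r} (\<lambda>s. c * (?P d s + ?P d' (r - s)))"
      using r by (intro integral_pos_of_continuous_pos turn_pos dd'
          continuous_intros cont_turn)
    also have "\<dots> = integral {0..r} (\<lambda>s. c * ?P d s) + integral {0..r} (\<lambda>s. c * ?P d' (r - s))"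
      unfolding distrib_left
      by (rule Henstock_Kurzweil_Integration.integral_add[OF intP[OF dd'(1)] intP'[OF dd'(2)]])
    also have "\<dots> = B d + B d'"
      by (simp only: reflect B_def)
    finally show ?thesis .
  qed
  then have "0 < (\<Sum>d\<in>darts G. B d)"
    by (rule sum_darts_pos_of_turns_pos[OF G(1,3,4)])
  also have "\<dots> = (\<Sum>e\<in>arcs G. B (e, True) + B (e, False))"
    by (rule sum_darts)
  also have "\<dots> \<le> (\<Sum>e\<in>arcs G. integral {0..1 - r} (\<lambda>a. c * Q e (a + r) - c * Q e a)
      + B (e, True) + B (e, False))"
  proof (rule sum_mono)
    fix e assume e: "e \<in> arcs G"
    have "0 \<le> integral {0..1 - r} (\<lambda>a. c * Q e (a + r) - c * Q e a)"
      unfolding right_diff_distrib[symmetric]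
      using edge_pos[OF e] by (intro Henstock_Kurzweil_Integration.integral_nonneg
          integrable_continuous_interval continuous_intros cont_edge e) (auto intro: less_imp_le)
    then show "B (e, True) + B (e, False) \<le> integral {0..1 - r} (\<lambda>a. c * Q e (a + r) - c * Q e a)
        + B (e, True) + B (e, False)"
      by simp
  qed
  also have "\<dots> = (\<Sum>e\<in>arcs G. r * (c * Q e 1))"
  proof (rule sum.cong)
    fix e assume e: "e \<in> arcs G"
    have "continuous_on {0..1} (\<lambda>a. c * Q e a)"
      by (intro continuous_intros cont e)
    then show "integral {0..1 - r} (\<lambda>a. c * Q e (a + r) - c * Q e a) + B (e, True) + B (e, False)
        = r * (c * Q e 1)"
      using integral_window_average[of "\<lambda>a. c * Q e a" r] r
      by (simp add: B_def dart_primitive_def right_diff_distrib)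
  qed simp
  also have "\<dots> = 0"
    by (simp add: total flip: sum_distrib_left)
  finally show False
    by simp
qed

section \<open>Integration over the graph\<close>

text \<open>
  The graph measure is the image, under gluing, of the product of the counting measure on the
  edges with Lebesgue measure on the unit interval, so that Fubini's theorem applies.
\<close>

lemma
  fixes g :: "('v, 'e) graph_point \<Rightarrow> real"
  assumes G: "fin_digraph G"
    and g: "\<And>e. e \<in> arcs G \<Longrightarrow> (\<lambda>t. g (edge_map G e t)) absolutely_integrable_on {0..1}"
  shows integrable_graph_measure: "integrable (graph_measure G) g"
    and integral_graph_measure: "(LINT x|graph_measure G. g x) =
      (\<Sum>e\<in>arcs G. integral {0..1} (\<lambda>t. g (edge_map G e t)))"
proof -
  interpret fin_digraph G by fact
  let ?I = "lebesgue_on {0..1::real}"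
  let ?C = "count_space (arcs G)"
  let ?glue = "\<lambda>(e, t). edge_map G e t"
  interpret I: finite_measure ?I
    by (rule finite_measure_lebesgue_on) simp
  interpret C: sigma_finite_measure ?C
    by (rule sigma_finite_measure_count_space_finite) simp
  interpret P: pair_sigma_finite ?C ?I ..
  have wf: "wf_digraph G" ..
  have in_points: "edge_map G e t \<in> graph_points G" if "e \<in> arcs G" "t \<in> {0..1}" for e t
    using edge_part_points[OF wf that(1)] that(2) unfolding edge_part_def by blast
  have preimage: "edge_map G e -` A \<inter> {0..1} = edge_part G A e" for A e
    by (auto simp: edge_part_def)
  have edge_measurable: "edge_map G e \<in> ?I \<rightarrow>\<^sub>M graph_measure G" if e: "e \<in> arcs G" for e
  proof (rule measurableI)
    show "edge_map G e t \<in> space (graph_measure G)" if "t \<in> space ?I" for t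
      using that in_points[OF e] by (simp add: space_graph_measure)
    show "edge_map G e -` A \<inter> space ?I \<in> sets ?I" if "A \<in> sets (graph_measure G)" for A
      using that e by (auto simp: preimage sets_graph_measure[OF wf] graph_sets_def
          sets_restrict_space_iff edge_part_def)
  qed
  have glue: "?glue \<in> ?C \<Otimes>\<^sub>M ?I \<rightarrow>\<^sub>M graph_measure G"
    by (rule measurable_pair_measure_countable1)
      (use edge_measurable in \<open>auto intro: countable_finite\<close>)
  have distr: "graph_measure G = distr (?C \<Otimes>\<^sub>M ?I) (graph_measure G) ?glue"
  proof (rule measure_eqI)
    fix A assume A: "A \<in> sets (graph_measure G)"
    have "emeasure (distr (?C \<Otimes>\<^sub>M ?I) (graph_measure G) ?glue) A =
        (\<Sum>e\<in>arcs G. emeasure ?I (Pair e -` (?glue -` A \<inter> space (?C \<Otimes>\<^sub>M ?I))))"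
      using glue A by (simp add: emeasure_distr I.emeasure_pair_measure_alt
          nn_integral_count_space_finite measurable_sets)
    also have "\<dots> = (\<Sum>e\<in>arcs G. emeasure lebesgue (edge_part G A e))"
    proof (rule sum.cong)
      fix e assume "e \<in> arcs G"
      then have "Pair e -` (?glue -` A \<inter> space (?C \<Otimes>\<^sub>M ?I)) = edge_part G A e"
        by (auto simp: space_pair_measure edge_part_def)
      then show "emeasure ?I (Pair e -` (?glue -` A \<inter> space (?C \<Otimes>\<^sub>M ?I))) =
          emeasure lebesgue (edge_part G A e)"
        by (simp add: emeasure_restrict_space edge_part_subset)
    qed simp
    also have "\<dots> = emeasure (graph_measure G) A"
      using A by (simp add: emeasure_graph_measure[OF wf] sets_graph_measure[OF wf])
    finally show "emeasure (graph_measure G) A =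
        emeasure (distr (?C \<Otimes>\<^sub>M ?I) (graph_measure G) ?glue) A" by simp
  qed simp
  have int_edge: "integrable ?I (\<lambda>t. g (edge_map G e t))" if "e \<in> arcs G" for e
    using g[OF that] by (simp add: integrable_restrict_space set_integrable_def)
  have g_measurable: "g \<in> borel_measurable (graph_measure G)"
  proof (rule measurableI)
    fix B :: "real set" assume B: "B \<in> sets borel"
    have "edge_part G (g -` B \<inter> graph_points G) e \<in> sets lebesgue" if e: "e \<in> arcs G" for e
    proof -
      have "(\<lambda>t. g (edge_map G e t)) -` B \<inter> space ?I \<in> sets ?I"
        using borel_measurable_integrable[OF int_edge[OF e]] B by (rule measurable_sets)
      moreover have "(\<lambda>t. g (edge_map G e t)) -` B \<inter> space ?I = edge_part G (g -` B \<inter> graph_points G) e"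
        using in_points[OF e] by (auto simp: edge_part_def)
      ultimately show ?thesis
        by (simp add: sets_restrict_space_iff)
    qed
    then show "g -` B \<inter> space (graph_measure G) \<in> sets (graph_measure G)"
      by (simp add: space_graph_measure sets_graph_measure[OF wf] graph_sets_def)
  qed simp
  have int: "integrable (?C \<Otimes>\<^sub>M ?I) (\<lambda>p. g (?glue p))"
  proof (rule P.Fubini_integrable)
    show "(\<lambda>p. g (?glue p)) \<in> borel_measurable (?C \<Otimes>\<^sub>M ?I)"
      by (rule measurable_compose[OF glue g_measurable])
    show "integrable ?C (\<lambda>e. \<integral>t. norm (g (?glue (e, t))) \<partial>?I)"
      by (simp add: integrable_count_space)
    show "AE e in ?C. integrable ?I (\<lambda>t. g (?glue (e, t)))"
      using int_edge by (simp add: AE_count_space)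
  qed
  then show "integrable (graph_measure G) g"
    by (subst distr) (simp add: integrable_distr_eq[OF glue g_measurable])
  have "(LINT x|graph_measure G. g x) = (LINT p|(?C \<Otimes>\<^sub>M ?I). g (?glue p))"
    by (subst distr) (rule integral_distr[OF glue g_measurable])
  also have "\<dots> = (LINT e|?C. LINT t|?I. g (?glue (e, t)))"
    by (rule P.integral_fst'[OF int, symmetric])
  also have "\<dots> = (\<Sum>e\<in>arcs G. LINT t|?I. g (edge_map G e t))"
    by (simp add: lebesgue_integral_count_space_finite)
  also have "\<dots> = (\<Sum>e\<in>arcs G. integral {0..1} (\<lambda>t. g (edge_map G e t)))"
  proof (rule sum.cong)
    fix e assume e: "e \<in> arcs G"
    have "(LINT t|?I. g (edge_map G e t)) = (LINT t:{0..1}|lebesgue. g (edge_map G e t))"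
      by (simp add: integral_restrict_space set_lebesgue_integral_def)
    then show "(LINT t|?I. g (edge_map G e t)) = integral {0..1} (\<lambda>t. g (edge_map G e t))"
      using set_lebesgue_integral_eq_integral(2)[OF g[OF e]] by simp
  qed simp
  finally show "(LINT x|graph_measure G. g x) =
      (\<Sum>e\<in>arcs G. integral {0..1} (\<lambda>t. g (edge_map G e t)))" .
qed

text \<open>
  The image of a subset of \<open>e\<close> meets other edges, and the remainder of \<open>e\<close> itself if \<open>e\<close> is a loop,
  only in end points.  The set \<open>F\<close> collects these end points; it affects neither closedness nor
  integrals.
\<close>

lemma edge_part_edge_image:
  assumes "K \<subseteq> {0..1}"
  obtains F where "F \<subseteq> {0, 1}"
    and "edge_part G (edge_map G e ` K) e' = (if e' = e then K else {}) \<union> F"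
proof
  let ?S = "edge_part G (edge_map G e ` K) e'"
  show "?S \<inter> {0, 1} \<subseteq> {0, 1}"
    by simp
  have "x \<in> ?S \<longleftrightarrow> x \<in> (if e' = e then K else {}) \<union> (?S \<inter> {0, 1})" for x
    using assms by (cases "x = 0 \<or> x = 1") (auto simp: edge_part_def edge_map_def split: if_splits)
  then show "?S = (if e' = e then K else {}) \<union> (?S \<inter> {0, 1})"
    by (rule set_eqI)
qed

lemma continuous_map_edge_map:
  assumes "wf_digraph G" "e \<in> arcs G"
  shows "continuous_map (top_of_set {0..1}) (graph_topology G) (edge_map G e)"
proof -
  have "edge_map G e t \<in> graph_points G" if "t \<in> {0..1}" for t
    using edge_part_points[OF assms] that unfolding edge_part_def by blast
  then show ?thesis
    using assms(2) unfolding continuous_map_def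
    by (auto simp: topspace_graph_topology[OF assms(1)] openin_graph_topology edge_part_def Pi_iff)
qed

lemma edge_segment_closed_connected:
  assumes G: "wf_digraph G" "e \<in> arcs G" and ab: "0 \<le> a" "a \<le> b" "b \<le> 1"
  shows "edge_map G e ` {a..b} \<in> closed_connected_sets G"
proof -
  have sub: "{a..b} \<subseteq> {0..1}"
    using ab by auto
  have "connectedin (graph_topology G) (edge_map G e ` {a..b})"
    using sub by (intro connectedin_continuous_map_image[OF continuous_map_edge_map[OF G]])
      (simp add: connectedin_subtopology)
  moreover have "closedin (graph_topology G) (edge_map G e ` {a..b})"
    unfolding closedin_graph_topology[OF G(1)]
  proof (intro conjI ballI)
    show "edge_map G e ` {a..b} \<subseteq> graph_points G"
      using edge_part_points[OF G] sub unfolding edge_part_def by blast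
  next
    fix e' assume "e' \<in> arcs G"
    let ?S = "edge_part G (edge_map G e ` {a..b}) e'"
    obtain F where F: "F \<subseteq> {0, 1}" and S: "?S = (if e' = e then {a..b} else {}) \<union> F"
      by (rule edge_part_edge_image[OF sub])
    have "closed F"
      by (rule finite_imp_closed[OF finite_subset[OF F]]) simp
    then show "closed ?S"
      unfolding S by auto
  qed
  ultimately show ?thesis
    using ab by (simp add: closed_connected_sets_def)
qed

lemma closed_connected_in_graph_sets:
  assumes "wf_digraph G" "U \<in> closed_connected_sets G"
  shows "U \<in> graph_sets G"
  using assms by (auto simp: closed_connected_sets_def closedin_graph_topology graph_sets_def borel_closed)

lemma edge_segment_integral:
  fixes f :: "('v, 'e) graph_point \<Rightarrow> real"
  assumes G: "fin_digraph G" "e \<in> arcs G" and ab: "0 \<le> a" "a \<le> b" "b \<le> 1"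
    and f: "\<And>e. e \<in> arcs G \<Longrightarrow> (\<lambda>t. f (edge_map G e t)) absolutely_integrable_on {0..1}"
  shows "(LINT x:edge_map G e ` {a..b}|graph_measure G. f x) =
    integral {a..b} (\<lambda>t. f (edge_map G e t))"
proof -
  interpret fin_digraph G by fact
  have wf: "wf_digraph G" ..
  let ?U = "edge_map G e ` {a..b}"
  let ?g = "\<lambda>x. indicat_real ?U x *\<^sub>R f x"
  have sub: "{a..b} \<subseteq> {0..1}"
    using ab by auto
  have U: "?U \<in> graph_sets G"
    by (rule closed_connected_in_graph_sets[OF wf edge_segment_closed_connected[OF wf G(2) ab]])
  have on_edge: "indicat_real ?U (edge_map G e' t) = indicat_real (edge_part G ?U e') t"
    if "t \<in> {0..1}" for e' t
    using that by (simp add: indicator_def edge_part_def)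
  have abs_int: "(\<lambda>t. ?g (edge_map G e' t)) absolutely_integrable_on {0..1}"
    if e': "e' \<in> arcs G" for e'
  proof -
    have "(\<lambda>t. f (edge_map G e' t)) absolutely_integrable_on edge_part G ?U e'"
      using U e' by (intro set_integrable_subset[OF f[OF e']] edge_part_subset)
        (simp add: graph_sets_def)
    then have "(\<lambda>t. indicat_real (edge_part G ?U e') t *\<^sub>R f (edge_map G e' t))
        absolutely_integrable_on {0..1}"
      unfolding set_integrable_def
      by (rule Bochner_Integration.integrable_cong[THEN iffD1, rotated 2])
        (use edge_part_subset[of G ?U e'] in \<open>auto simp: indicator_def\<close>)
    then show ?thesis
      by (rule set_integrable_cong[THEN iffD1, rotated 3]) (simp_all add: on_edge)
  qed
  have edge_int: "integral {0..1} (\<lambda>t. ?g (edge_map G e' t)) =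
      (if e' = e then integral {a..b} (\<lambda>t. f (edge_map G e t)) else 0)" for e'
  proof -
    let ?S = "edge_part G ?U e'" and ?K = "if e' = e then {a..b} else {}"
    have "integral {0..1} (\<lambda>t. ?g (edge_map G e' t)) =
        integral {0..1} (\<lambda>t. if t \<in> ?S then f (edge_map G e' t) else 0)"
      by (rule Henstock_Kurzweil_Integration.integral_cong)
        (auto simp: on_edge split: split_indicator)
    also have "\<dots> = integral ?S (\<lambda>t. f (edge_map G e' t))"
      using edge_part_subset[of G ?U e'] by (simp add: integral_restrict_Int inf_absorb1)
    also have "\<dots> = integral ?K (\<lambda>t. f (edge_map G e' t))"
    proof (rule integral_spike_set)
      obtain F where F: "F \<subseteq> {0, 1}" and S: "?S = ?K \<union> F"
        by (rule edge_part_edge_image[OF sub])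
      have "finite F"
        using F by (rule finite_subset) simp
      then show "negligible {t \<in> ?S - ?K. f (edge_map G e' t) \<noteq> 0}"
        by (rule negligible_finite[OF finite_subset[rotated]]) (unfold S, blast)
      have "{t \<in> ?K - ?S. f (edge_map G e' t) \<noteq> 0} = {}"
        unfolding S by blast
      then show "negligible {t \<in> ?K - ?S. f (edge_map G e' t) \<noteq> 0}"
        by (simp only: negligible_empty)
    qed
    finally show ?thesis
      by simp
  qed
  have "(LINT x:?U|graph_measure G. f x) = (\<Sum>e'\<in>arcs G. integral {0..1} (\<lambda>t. ?g (edge_map G e' t)))"
    unfolding set_lebesgue_integral_def by (rule integral_graph_measure[OF G(1) abs_int])
  also have "\<dots> = integral {a..b} (\<lambda>t. f (edge_map G e t))"
    unfolding edge_int using G(2) by simp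
  finally show ?thesis .
qed

text \<open>
  If both segments lie on the same edge they may touch but not overlap, which leaves a finite
  intersection in all cases.
\<close>

lemma edge_segments_union_integral:
  fixes f :: "('v, 'e) graph_point \<Rightarrow> real"
  assumes G: "fin_digraph G" "e \<in> arcs G" "e' \<in> arcs G"
    and K: "0 \<le> a" "a \<le> b" "b \<le> 1" and K': "0 \<le> a'" "a' \<le> b'" "b' \<le> 1"
    and overlap: "e = e' \<Longrightarrow> b \<le> a' \<or> b' \<le> a"
    and f: "\<And>e. e \<in> arcs G \<Longrightarrow> (\<lambda>t. f (edge_map G e t)) absolutely_integrable_on {0..1}"
  shows "(LINT x:edge_map G e ` {a..b} \<union> edge_map G e' ` {a'..b'}|graph_measure G. f x) =
    integral {a..b} (\<lambda>t. f (edge_map G e t)) + integral {a'..b'} (\<lambda>t. f (edge_map G e' t))"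
proof -
  interpret fin_digraph G by fact
  have wf: "wf_digraph G" ..
  let ?U = "edge_map G e ` {a..b}" and ?U' = "edge_map G e' ` {a'..b'}"
  have sets: "?U \<in> sets (graph_measure G)" "?U' \<in> sets (graph_measure G)"
    unfolding sets_graph_measure[OF wf]
    by (intro closed_connected_in_graph_sets[OF wf] edge_segment_closed_connected[OF wf] G K K')+
  have "?U \<inter> ?U' \<in> null_sets (graph_measure G)"
  proof (rule null_setsI)
    have "finite (edge_part G (?U \<inter> ?U') e'')" for e''
    proof (rule finite_subset)
      have sub: "{a..b} \<subseteq> {0..1}" "{a'..b'} \<subseteq> {0..1}"
        using K K' by auto
      obtain F where F: "F \<subseteq> {0, 1}" "edge_part G ?U e'' = (if e'' = e then {a..b} else {}) \<union> F"
        by (rule edge_part_edge_image[OF sub(1)])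
      obtain F' where F': "F' \<subseteq> {0, 1}" "edge_part G ?U' e'' = (if e'' = e' then {a'..b'} else {}) \<union> F'"
        by (rule edge_part_edge_image[OF sub(2)])
      have "x = a \<or> x = b" if "e = e'" "x \<in> {a..b}" "x \<in> {a'..b'}" for x
        using overlap[OF that(1)] that(2,3) by auto
      then show "edge_part G (?U \<inter> ?U') e'' \<subseteq> {0, 1, a, b}"
        unfolding edge_part_Int F(2) F'(2) using F(1) F'(1) by (force split: if_splits)
    qed simp
    then have "emeasure lebesgue (edge_part G (?U \<inter> ?U') e'') = 0" for e''
      using negligible_finite negligible_iff_null_sets by blast
    then show "emeasure (graph_measure G) (?U \<inter> ?U') = 0"
      using sets by (simp add: emeasure_graph_measure[OF wf] sets_graph_measure[OF wf] del: emeasure_completion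
          flip: sets_graph_measure[OF wf])
    show "?U \<inter> ?U' \<in> sets (graph_measure G)"
      using sets by auto
  qed
  then have ae: "AE x in graph_measure G. \<not> (x \<in> ?U \<and> x \<in> ?U')"
    by (rule AE_I'[OF _ subsetI]) auto
  have int: "set_integrable (graph_measure G) A f" if "A \<in> sets (graph_measure G)" for A
    unfolding set_integrable_def
    using that integrable_graph_measure[OF G(1) f] by (rule integrable_mult_indicator)
  show ?thesis
    using set_integral_Un_AE[OF ae sets int[OF sets(1)] int[OF sets(2)]]
    by (simp add: edge_segment_integral[OF G(1,2) K f] edge_segment_integral[OF G(1,3) K' f])
qed

text \<open>
  Measures of windows are thereby special cases of integrals over windows, with the constant
  function \<open>1\<close>.
\<close>

lemma measure_eq_set_integral_one:
  assumes "fin_digraph G" "U \<in> closed_connected_sets G"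
  shows "measure (graph_measure G) U = (LINT x:U|graph_measure G. 1)"
proof -
  have "U \<subseteq> space (graph_measure G)"
    using assms(2) closed_connected_in_graph_sets[OF fin_digraph.axioms(1)[OF assms(1)]]
    by (auto simp: space_graph_measure graph_sets_def)
  then show ?thesis
    by (simp add: set_lebesgue_integral_def inf_absorb1)
qed

section \<open>Windows around a vertex and the chord set\<close>

definition dart_segment :: "('v, 'e) pre_digraph \<Rightarrow> 'e \<times> bool \<Rightarrow> real \<Rightarrow> ('v, 'e) graph_point set" where
  "dart_segment G d s = edge_map G (fst d) ` (if snd d then {0..s} else {1 - s..1})"

lemma turn_closed_connected:
  assumes G: "wf_digraph G" and d: "d \<in> darts G" "d' \<in> darts G" "dart_start G d = dart_start G d'"
    and s: "0 \<le> s" "s \<le> 1" "0 \<le> s'" "s' \<le> 1"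
  shows "dart_segment G d s \<union> dart_segment G d' s' \<in> closed_connected_sets G"
proof -
  have seg: "dart_segment G d s \<in> closed_connected_sets G"
    if "d \<in> darts G" "0 \<le> s" "s \<le> 1" for d s
    using that unfolding dart_segment_def
    by (auto intro!: edge_segment_closed_connected[OF G] simp: darts_def)
  have start: "Vertex (dart_start G d) \<in> dart_segment G d s" if "0 \<le> s" for d s
    using that unfolding dart_segment_def dart_start_def
    by (auto simp: edge_map_def image_iff intro: bexI[of _ 0] bexI[of _ 1])
  have "dart_segment G d s \<inter> dart_segment G d' s' \<noteq> {}"
    using start[OF s(1), of d] start[OF s(3), of d'] d(3) by auto
  then show ?thesis
    using seg[OF d(1) s(1,2)] seg[OF d(2) s(3,4)]
    by (simp add: closed_connected_sets_def connectedin_Un closedin_Un)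
qed

text \<open>
  The bound \<open>s + s' \<le> 1\<close> prevents the two pieces from overlapping when \<open>d\<close> and \<open>d'\<close> are the two
  directions of one loop.
\<close>

lemma turn_integral:
  fixes f :: "('v, 'e) graph_point \<Rightarrow> real"
  assumes G: "fin_digraph G" and d: "d \<in> darts G" "d' \<in> darts G" "d \<noteq> d'"
    and s: "0 \<le> s" "0 \<le> s'" "s + s' \<le> 1"
    and f: "\<And>e. e \<in> arcs G \<Longrightarrow> (\<lambda>t. f (edge_map G e t)) absolutely_integrable_on {0..1}"
  defines "Q \<equiv> \<lambda>e s. integral {0..s} (\<lambda>t. f (edge_map G e t))"
  shows "(LINT x:dart_segment G d s \<union> dart_segment G d' s'|graph_measure G. f x) =
    dart_primitive Q d s + dart_primitive Q d' s'"
proof -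
  \<comment> \<open>The initial piece of a dart as an interval of coordinates on its edge.\<close>
  define lo where "lo d s = (if snd d then 0 else 1 - s)" for d :: "'e \<times> bool" and s :: real
  define hi where "hi d s = (if snd d then s else 1)" for d :: "'e \<times> bool" and s :: real
  have segment: "dart_segment G d s = edge_map G (fst d) ` {lo d s..hi d s}" for d s
    by (simp add: dart_segment_def lo_def hi_def)
  have prim: "integral {lo d s..hi d s} (\<lambda>t. f (edge_map G (fst d) t)) = dart_primitive Q d s"
    if "d \<in> darts G" "0 \<le> s" "s \<le> 1" for d s
  proof (cases "snd d")
    case False
    have "(\<lambda>t. f (edge_map G (fst d) t)) integrable_on {0..1}"
      using that(1) f set_lebesgue_integral_eq_integral(1) by (fastforce simp: darts_def)
    then have "Q (fst d) (1 - s) + integral {1 - s..1} (\<lambda>t. f (edge_map G (fst d) t)) = Q (fst d) 1"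
      unfolding Q_def using that by (intro Henstock_Kurzweil_Integration.integral_combine) auto
    then show ?thesis
      using False by (simp add: lo_def hi_def dart_primitive_def)
  qed (simp add: lo_def hi_def dart_primitive_def Q_def)
  have s1: "s \<le> 1" "s' \<le> 1"
    using s by auto
  have "fst d = fst d' \<Longrightarrow> hi d s \<le> lo d' s' \<or> hi d' s' \<le> lo d s"
    using d(3) s by (auto simp: hi_def lo_def prod_eq_iff)
  then have "(LINT x:dart_segment G d s \<union> dart_segment G d' s'|graph_measure G. f x) =
      integral {lo d s..hi d s} (\<lambda>t. f (edge_map G (fst d) t)) +
      integral {lo d' s'..hi d' s'} (\<lambda>t. f (edge_map G (fst d') t))"
    unfolding segment using d(1,2) s s1
    by (intro edge_segments_union_integral[OF G _ _ _ _ _ _ _ _ _ f])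
      (auto simp: lo_def hi_def darts_def)
  then show ?thesis
    using d s s1 by (simp add: prim)
qed

theorem theorem8:
  fixes G :: "('v, 'e) pre_digraph"
  assumes "fin_digraph G"
    and "Digraph_Component.connected G"
    and "arcs G \<noteq> {}"
    and "\<forall>v\<in>verts G. graph_degree G v \<noteq> 1"
  shows "{0..1} \<subseteq> chord_set G"
proof
  fix r :: real assume r: "r \<in> {0..1}"
  interpret fin_digraph G by fact
  have wf: "wf_digraph G" ..
  have "\<exists>U\<in>closed_connected_sets G. measure (graph_measure G) U = r \<and>
      (LINT x:U|graph_measure G. f x) = 0"
    if f: "f \<in> graph_L1 G" and total: "(LINT x|graph_measure G. f x) = 0" for f
  proof -
    have f_int: "(\<lambda>t. f (edge_map G e t)) absolutely_integrable_on {0..1}" if "e \<in> arcs G" for e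
      using f that by (intro riemann_integrable_imp_absolutely_integrable) (auto simp: graph_L1_def)
    have one_int: "(\<lambda>t. 1 :: real) absolutely_integrable_on {0..1::real}"
      by simp
    define Q where "Q e s = integral {0..s} (\<lambda>t. f (edge_map G e t))" for e s
    have f_int': "(\<lambda>t. f (edge_map G e t)) integrable_on {0..1}" if "e \<in> arcs G" for e
      using f_int[OF that] set_lebesgue_integral_eq_integral(1) by blast
    have edge: ?thesis if e: "e \<in> arcs G" and a: "a \<in> {0..1 - r}" and zero: "Q e (a + r) - Q e a = 0" for e a
    proof (intro bexI conjI)
      have ar: "0 \<le> a" "a \<le> a + r" "a + r \<le> 1"
        using a r by auto
      show U: "edge_map G e ` {a..a + r} \<in> closed_connected_sets G"
        by (rule edge_segment_closed_connected[OF wf e ar])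
      show "measure (graph_measure G) (edge_map G e ` {a..a + r}) = r"
        using edge_segment_integral[OF assms(1) e ar, where f = "\<lambda>_. 1", OF one_int] ar
        by (simp add: measure_eq_set_integral_one[OF assms(1) U])
      have "Q e a + integral {a..a + r} (\<lambda>t. f (edge_map G e t)) = Q e (a + r)"
        unfolding Q_def using ar
        by (intro Henstock_Kurzweil_Integration.integral_combine
            integrable_subinterval_real[OF f_int'[OF e]]) auto
      then show "(LINT x:edge_map G e ` {a..a + r}|graph_measure G. f x) = 0"
        using zero by (simp add: edge_segment_integral[OF assms(1) e ar f_int])
    qed
    have turn: ?thesis
      if d: "d \<in> darts G" "d' \<in> darts G" "d \<noteq> d'" "dart_start G d = dart_start G d'"
        and s: "s \<in> {0..r}" and zero: "dart_primitive Q d s + dart_primitive Q d' (r - s) = 0"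
      for d d' s
    proof (intro bexI conjI)
      have s': "0 \<le> s" "0 \<le> r - s" "s + (r - s) \<le> 1" "s \<le> 1" "r - s \<le> 1"
        using s r by auto
      let ?U = "dart_segment G d s \<union> dart_segment G d' (r - s)"
      show U: "?U \<in> closed_connected_sets G"
        by (rule turn_closed_connected[OF wf d(1,2,4) s'(1,4,2,5)])
      show "measure (graph_measure G) ?U = r"
        using turn_integral[OF assms(1) d(1-3) s'(1-3), where f = "\<lambda>_. 1", OF one_int] s'
        by (simp add: measure_eq_set_integral_one[OF assms(1) U] dart_primitive_def)
      show "(LINT x:?U|graph_measure G. f x) = 0"
        using turn_integral[OF assms(1) d(1-3) s'(1-3) f_int] zero by (simp add: Q_def[abs_def])
    qed
    \<comment> \<open>For \<open>r = 0\<close> a single point is a window whose integral is \<open>0\<close>.\<close>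
    show ?thesis
    proof (cases "r = 0")
      case True
      then show ?thesis
        using assms(3) edge[of _ 0] by auto
    next
      case False
      have "(\<exists>e\<in>arcs G. \<exists>a\<in>{0..1 - r}. Q e (a + r) - Q e a = 0) \<or>
        (\<exists>d\<in>darts G. \<exists>d'\<in>darts G. d \<noteq> d' \<and> dart_start G d = dart_start G d' \<and>
          (\<exists>s\<in>{0..r}. dart_primitive Q d s + dart_primitive Q d' (r - s) = 0))"
      proof (rule sliding_window_zero[OF assms])
        show "continuous_on {0..1} (Q e)" if "e \<in> arcs G" for e
          unfolding Q_def[abs_def] by (rule indefinite_integral_continuous_1[OF f_int'[OF that]])
        show "(\<Sum>e\<in>arcs G. Q e 1) = 0"
          using integral_graph_measure[OF assms(1) f_int] total by (simp add: Q_def)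
      qed (use r False in \<open>auto simp: Q_def\<close>)
      then show ?thesis
        using edge turn by blast
    qed
  qed
  then show "r \<in> chord_set G"
    by (auto simp: chord_set_def closed_connected_sets_of_measure_def)
qed

end
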